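(* The group $\Gamma_\tau$ is residually pro-$p$.
   Context: $q$ is a power of an odd prime $p$, $c\in\mathbb{F}_q^\ast$ a non-square, $\tau\in\mathbb{F}_q^\ast\setminus\{1\}$, $K=\mathbb{F}_q(t)$, $D=K\{Z,F\}/(Z^2=c,\ F^2=t(t-1),\ ZF=-FZ)$, a quaternion algebra over $K$. $\mathbb{F}_q[Z]\subset D$ is a field with $q^2$ elements, with norm $N(w)=w^{q+1}$. For $\xi\in\mathbb{F}_q[Z]$ put $\gamma_\xi=tZ+\xi F$. For $N(\xi)=-c$ let $a_\xi$ be the image of $\gamma_\xi Z$ in $D^\ast/K^\ast$, and for $N(\eta)=\frac{c\tau}{1-\tau}$ let $b_\eta$ be the image of $\gamma_\eta Z$ in $D^\ast/K^\ast$. $\Gamma_\tau\subset D^\ast/K^\ast$ is the subgroup generated by all these $a_\xi$ and $b_\eta$. A group is residually pro-$p$ if for every element $g\neq1$ there is a homomorphism to a pro-$p$ group (equivalently, to a finite $p$-group) under which $g$ has non-trivial image. *)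

theory Defs
  imports
    "HOL-Algebra.Ring"
    "HOL-Algebra.Generated_Groups"
    "HOL-Computational_Algebra.Polynomial"
    "HOL-Computational_Algebra.Fraction_Field"
    "HOL-Computational_Algebra.Primes"
    "HOL-Library.Cardinality"
begin

section \<open>The quaternion algebra \<open>k{Z,F}/(Z\<^sup>2 = a, F\<^sup>2 = b, ZF = -FZ)\<close>\<close>

text \<open>\<open>Quat x0 x1 x2 x3\<close> stands for \<open>x0 + x1 Z + x2 F + x3 ZF\<close>.  That this model has the
  presentation in the title is shown in \<open>quat_relations\<close> and \<open>quat_universal\<close> below.\<close>

datatype 'k quat = Quat (q0: 'k) (q1: 'k) (q2: 'k) (q3: 'k)

definition quaternion_algebra :: "'k::field \<Rightarrow> 'k \<Rightarrow> 'k quat ring" where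
  "quaternion_algebra a b =
    \<lparr> carrier = UNIV,
      monoid.mult = (\<lambda>x y. Quat
        (q0 x * q0 y + a * q1 x * q1 y + b * q2 x * q2 y - a * b * q3 x * q3 y)
        (q0 x * q1 y + q1 x * q0 y - b * q2 x * q3 y + b * q3 x * q2 y)
        (q0 x * q2 y + q2 x * q0 y + a * q1 x * q3 y - a * q3 x * q1 y)
        (q0 x * q3 y + q3 x * q0 y + q1 x * q2 y - q2 x * q1 y)),
      one = Quat 1 0 0 0,
      zero = Quat 0 0 0 0,
      add = (\<lambda>x y. Quat (q0 x + q0 y) (q1 x + q1 y) (q2 x + q2 y) (q3 x + q3 y)) \<rparr>"

definition quat_scalar :: "'k::field \<Rightarrow> 'k quat" where
  "quat_scalar x = Quat x 0 0 0"

definition quat_Z :: "'k::field quat" where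
  "quat_Z = Quat 0 1 0 0"

definition quat_F :: "'k::field quat" where
  "quat_F = Quat 0 0 1 0"

lemma quat_carrier [simp]: "carrier (quaternion_algebra a b) = UNIV"
  by (simp add: quaternion_algebra_def)

lemma quat_ring: "ring (quaternion_algebra (a::'k::field) b)"
proof (rule ringI)
  show "abelian_group (quaternion_algebra a b)"
  proof (rule abelian_groupI)
    fix x assume "x \<in> carrier (quaternion_algebra a b)"
    show "\<exists>y\<in>carrier (quaternion_algebra a b).
            y \<oplus>\<^bsub>quaternion_algebra a b\<^esub> x = \<zero>\<^bsub>quaternion_algebra a b\<^esub>"
      by (rule bexI[of _ "Quat (- q0 x) (- q1 x) (- q2 x) (- q3 x)"])
        (simp_all add: quaternion_algebra_def)
  qed (simp_all add: quaternion_algebra_def add_ac)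
  show "Group.monoid (quaternion_algebra a b)"
    by (rule Group.monoidI) (simp_all add: quaternion_algebra_def algebra_simps)
qed (simp_all add: quaternion_algebra_def algebra_simps)

lemma quat_relations:
  fixes a b :: "'k::field"
  defines "D \<equiv> quaternion_algebra a b"
  shows "quat_Z \<otimes>\<^bsub>D\<^esub> quat_Z = quat_scalar a"
    and "quat_F \<otimes>\<^bsub>D\<^esub> quat_F = quat_scalar b"
    and "quat_Z \<otimes>\<^bsub>D\<^esub> quat_F = \<ominus>\<^bsub>D\<^esub> (quat_F \<otimes>\<^bsub>D\<^esub> quat_Z)"
proof -
  interpret D: ring D unfolding D_def by (rule quat_ring)
  show "quat_Z \<otimes>\<^bsub>D\<^esub> quat_Z = quat_scalar a" "quat_F \<otimes>\<^bsub>D\<^esub> quat_F = quat_scalar b"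
    by (simp_all add: D_def quaternion_algebra_def quat_Z_def quat_F_def quat_scalar_def)
  have "\<ominus>\<^bsub>D\<^esub> (quat_F \<otimes>\<^bsub>D\<^esub> quat_Z) = quat_Z \<otimes>\<^bsub>D\<^esub> quat_F"
    by (rule D.minus_equality)
      (simp_all add: D_def quaternion_algebra_def quat_Z_def quat_F_def)
  then show "quat_Z \<otimes>\<^bsub>D\<^esub> quat_F = \<ominus>\<^bsub>D\<^esub> (quat_F \<otimes>\<^bsub>D\<^esub> quat_Z)"
    by simp
qed

lemma quat_universal:
  fixes a b :: "'k::field" and h :: "'k \<Rightarrow> 'r::ring_1" and z f :: 'r
  defines "D \<equiv> quaternion_algebra a b"
  assumes h: "h 1 = 1" "\<And>x y. h (x + y) = h x + h y" "\<And>x y. h (x * y) = h x * h y"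
    and central: "\<And>x r. h x * r = r * h x"
    and rels: "z * z = h a" "f * f = h b" "z * f = - (f * z)"
  shows "\<exists>!\<phi>. (\<forall>x y. \<phi> (x \<oplus>\<^bsub>D\<^esub> y) = \<phi> x + \<phi> y) \<and> (\<forall>x y. \<phi> (x \<otimes>\<^bsub>D\<^esub> y) = \<phi> x * \<phi> y) \<and>
           (\<forall>k. \<phi> (quat_scalar k) = h k) \<and> \<phi> quat_Z = z \<and> \<phi> quat_F = f"
proof (rule ex1I)
  define \<phi> where "\<phi> x = h (q0 x) + h (q1 x) * z + h (q2 x) * f + h (q3 x) * (z * f)" for x
  have h0: "h 0 = 0" using h(2)[of 0 0] by simp
  have hm: "h (- x) = - h x" for x using h(2)[of x "-x"] h0 by (simp add: eq_neg_iff_add_eq_0 add.commute)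
  have hd: "h (x - y) = h x - h y" for x y using h(2)[of x "-y"] hm by simp
  have comm: "z * (h x * s) = h x * (z * s)" "z * h x = h x * z"
    "f * (h x * s) = h x * (f * s)" "f * h x = h x * f" for s x
    by (metis central mult.assoc)+
  have merge: "h x * h y = h (x * y)" "h x * (h y * s) = h (x * y) * s" for x y s
    by (simp_all add: h(3) mult.assoc)
  have fz: "f * z = - (z * f)" using rels(3) by simp
  have rels': "z * (z * r) = h a * r" "f * (f * r) = h b * r" "f * (z * r) = - (z * (f * r))" for r
    using rels fz by (metis mult.assoc, metis mult.assoc, metis mult.assoc mult_minus_left)
  have "\<phi> (x \<oplus>\<^bsub>D\<^esub> y) = \<phi> x + \<phi> y" for x y
    by (simp add: \<phi>_def D_def quaternion_algebra_def h algebra_simps)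
  moreover have "\<phi> (x \<otimes>\<^bsub>D\<^esub> y) = \<phi> x * \<phi> y" for x y
    by (simp add: \<phi>_def D_def quaternion_algebra_def h(2) hd ring_distribs mult.assoc comm merge
        rels(1,2) fz rels' mult.commute[where 'a='k] mult.left_commute[where 'a='k])
  ultimately show "(\<forall>x y. \<phi> (x \<oplus>\<^bsub>D\<^esub> y) = \<phi> x + \<phi> y) \<and> (\<forall>x y. \<phi> (x \<otimes>\<^bsub>D\<^esub> y) = \<phi> x * \<phi> y) \<and>
           (\<forall>k. \<phi> (quat_scalar k) = h k) \<and> \<phi> quat_Z = z \<and> \<phi> quat_F = f"
    by (simp add: \<phi>_def quat_scalar_def quat_Z_def quat_F_def h0 h)
  fix \<psi>
  assume \<psi>: "(\<forall>x y. \<psi> (x \<oplus>\<^bsub>D\<^esub> y) = \<psi> x + \<psi> y) \<and> (\<forall>x y. \<psi> (x \<otimes>\<^bsub>D\<^esub> y) = \<psi> x * \<psi> y) \<and>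
           (\<forall>k. \<psi> (quat_scalar k) = h k) \<and> \<psi> quat_Z = z \<and> \<psi> quat_F = f"
  show "\<psi> = \<phi>"
  proof
    fix x
    have "x = quat_scalar (q0 x) \<oplus>\<^bsub>D\<^esub> (quat_scalar (q1 x) \<otimes>\<^bsub>D\<^esub> quat_Z) \<oplus>\<^bsub>D\<^esub>
      (quat_scalar (q2 x) \<otimes>\<^bsub>D\<^esub> quat_F) \<oplus>\<^bsub>D\<^esub> (quat_scalar (q3 x) \<otimes>\<^bsub>D\<^esub> (quat_Z \<otimes>\<^bsub>D\<^esub> quat_F))"
      by (simp add: D_def quaternion_algebra_def quat_scalar_def quat_Z_def quat_F_def)
    then have "\<psi> x = \<psi> (quat_scalar (q0 x) \<oplus>\<^bsub>D\<^esub> (quat_scalar (q1 x) \<otimes>\<^bsub>D\<^esub> quat_Z) \<oplus>\<^bsub>D\<^esub>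
      (quat_scalar (q2 x) \<otimes>\<^bsub>D\<^esub> quat_F) \<oplus>\<^bsub>D\<^esub> (quat_scalar (q3 x) \<otimes>\<^bsub>D\<^esub> (quat_Z \<otimes>\<^bsub>D\<^esub> quat_F)))"
      by (rule arg_cong)
    also have "\<dots> = \<phi> x"
      using \<psi> by (simp add: \<phi>_def)
    finally show "\<psi> x = \<phi> x" .
  qed
qed

definition quat_scalar_units :: "'k::field quat set" where
  "quat_scalar_units = quat_scalar ` (UNIV - {0})"

text \<open>The group \<open>D\<^sup>*/K\<^sup>*\<close>; its elements are the cosets \<open>K\<^sup>* u\<close>.\<close>

definition proj_units :: "'k::field \<Rightarrow> 'k \<Rightarrow> 'k quat set monoid" where
  "proj_units a b = units_of (quaternion_algebra a b) Mod quat_scalar_units"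

definition proj_class :: "'k::field \<Rightarrow> 'k \<Rightarrow> 'k quat \<Rightarrow> 'k quat set" where
  "proj_class a b u = quat_scalar_units #>\<^bsub>units_of (quaternion_algebra a b)\<^esub> u"

lemma quat_scalar_units_normal:
  "quat_scalar_units \<lhd> units_of (quaternion_algebra a (b::'k::field))"
proof -
  let ?D = "quaternion_algebra a b"
  interpret D: ring ?D by (rule quat_ring)
  interpret U: group "units_of ?D" by (rule D.units_group)
  have mul: "quat_scalar x \<otimes>\<^bsub>?D\<^esub> quat_scalar y = quat_scalar (x * y)" for x y
    by (simp add: quaternion_algebra_def quat_scalar_def)
  have qone: "\<one>\<^bsub>?D\<^esub> = quat_scalar 1"
    by (simp add: quaternion_algebra_def quat_scalar_def)
  have unit: "quat_scalar x \<in> Units ?D" if "x \<noteq> 0" for x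
    unfolding Units_def using that
    by (auto simp: mul qone intro!: exI[of _ "quat_scalar (inverse x)"])
  have qinv: "inv\<^bsub>units_of ?D\<^esub> (quat_scalar x) = quat_scalar (inverse x)" if "x \<noteq> 0" for x
    by (rule U.inv_equality)
      (use that in \<open>auto simp: units_of_mult units_of_one units_of_carrier unit mul qone\<close>)
  have central: "x \<otimes>\<^bsub>?D\<^esub> quat_scalar y = quat_scalar y \<otimes>\<^bsub>?D\<^esub> x" for x y
    by (simp add: quaternion_algebra_def quat_scalar_def mult_ac)
  have sub: "subgroup quat_scalar_units (units_of ?D)"
  proof (rule U.subgroupI)
    show "quat_scalar_units \<subseteq> carrier (units_of ?D)"
      using unit by (auto simp: quat_scalar_units_def units_of_carrier)
    show "(quat_scalar_units :: 'k quat set) \<noteq> {}"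
      unfolding quat_scalar_units_def image_is_empty using one_neq_zero by blast
  qed (auto simp: quat_scalar_units_def units_of_mult mul qinv)
  show ?thesis
    unfolding U.normal_inv_iff
  proof (intro conjI ballI sub)
    fix x s :: "'k quat" assume x: "x \<in> carrier (units_of ?D)" and s: "s \<in> quat_scalar_units"
    obtain y where y: "s = quat_scalar y" using s by (auto simp: quat_scalar_units_def)
    have sc: "s \<in> carrier (units_of ?D)" using subgroup.subset[OF sub] s by blast
    have "x \<otimes>\<^bsub>units_of ?D\<^esub> s = s \<otimes>\<^bsub>units_of ?D\<^esub> x"
      by (simp add: units_of_mult y central)
    then have "x \<otimes>\<^bsub>units_of ?D\<^esub> s \<otimes>\<^bsub>units_of ?D\<^esub> inv\<^bsub>units_of ?D\<^esub> x = s"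
      using x sc by (simp add: U.m_assoc)
    then show "x \<otimes>\<^bsub>units_of ?D\<^esub> s \<otimes>\<^bsub>units_of ?D\<^esub> inv\<^bsub>units_of ?D\<^esub> x \<in> quat_scalar_units"
      using s by simp
  qed
qed

lemma proj_units_group: "group (proj_units a b)"
  unfolding proj_units_def by (rule normal.factorgroup_is_group[OF quat_scalar_units_normal])

section \<open>The group \<open>\<Gamma>\<^sub>\<tau>\<close>\<close>

text \<open>The type \<open>'a\<close> is \<open>\<bbbF>\<^sub>q\<close>, so \<open>q = CARD('a)\<close> and \<open>K = \<bbbF>\<^sub>q(t)\<close> is \<^typ>\<open>'a poly fract\<close>.\<close>

definition K_const :: "'a::finite_field \<Rightarrow> 'a poly fract" where
  "K_const x = Fract [:x:] 1"

definition K_t :: "'a::finite_field poly fract" where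
  "K_t = Fract [:0, 1:] 1"

definition D_alg :: "'a::finite_field \<Rightarrow> 'a poly fract quat ring" where
  "D_alg c = quaternion_algebra (K_const c) (K_t * (K_t - 1))"

definition D_const :: "'a::finite_field \<Rightarrow> 'a poly fract quat" where
  "D_const x = quat_scalar (K_const x)"

definition Fq_Z :: "'a::finite_field \<Rightarrow> 'a poly fract quat set" where
  "Fq_Z c = {D_const x \<oplus>\<^bsub>D_alg c\<^esub> (D_const y \<otimes>\<^bsub>D_alg c\<^esub> quat_Z) | x y. True}"

text \<open>The norm of \<open>\<bbbF>\<^sub>q[Z]\<close>, with values in the copy \<open>range D_const\<close> of \<open>\<bbbF>\<^sub>q\<close>.\<close>

definition Fq_Z_norm :: "'a::finite_field \<Rightarrow> 'a poly fract quat \<Rightarrow> 'a poly fract quat" where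
  "Fq_Z_norm c w = w [^]\<^bsub>D_alg c\<^esub> (CARD('a) + 1)"

definition gamma :: "'a::finite_field \<Rightarrow> 'a poly fract quat \<Rightarrow> 'a poly fract quat" where
  "gamma c \<xi> = (quat_scalar K_t \<otimes>\<^bsub>D_alg c\<^esub> quat_Z) \<oplus>\<^bsub>D_alg c\<^esub> (\<xi> \<otimes>\<^bsub>D_alg c\<^esub> quat_F)"

definition D_proj :: "'a::finite_field \<Rightarrow> 'a poly fract quat set monoid" where
  "D_proj c = proj_units (K_const c) (K_t * (K_t - 1))"

text \<open>The image of \<open>\<gamma>\<^sub>\<xi> Z\<close> in \<open>D\<^sup>*/K\<^sup>*\<close>; this is \<open>a\<^sub>\<xi>\<close> or \<open>b\<^sub>\<xi>\<close> according to the norm of \<open>\<xi>\<close>.\<close>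

definition gamma_Z_class :: "'a::finite_field \<Rightarrow> 'a poly fract quat \<Rightarrow> 'a poly fract quat set" where
  "gamma_Z_class c \<xi> =
    proj_class (K_const c) (K_t * (K_t - 1)) (gamma c \<xi> \<otimes>\<^bsub>D_alg c\<^esub> quat_Z)"

definition Gamma_gens :: "'a::finite_field \<Rightarrow> 'a \<Rightarrow> 'a poly fract quat set set" where
  "Gamma_gens c \<tau> =
    gamma_Z_class c ` {\<xi> \<in> Fq_Z c. Fq_Z_norm c \<xi> = D_const (- c)} \<union>
    gamma_Z_class c ` {\<eta> \<in> Fq_Z c. Fq_Z_norm c \<eta> = D_const (c * \<tau> / (1 - \<tau>))}"

definition Gamma_group :: "'a::finite_field \<Rightarrow> 'a \<Rightarrow> 'a poly fract quat set monoid" where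
  "Gamma_group c \<tau> = (D_proj c) \<lparr> carrier := generate (D_proj c) (Gamma_gens c \<tau>) \<rparr>"

lemma gamma_Z_Units:
  assumes "c \<noteq> 0" "\<xi> \<in> Fq_Z c"
  shows "gamma c \<xi> \<otimes>\<^bsub>D_alg c\<^esub> quat_Z \<in> Units (D_alg c)"
proof -
  interpret D: ring "D_alg c" unfolding D_alg_def by (rule quat_ring)
  have unitI: "u \<in> Units (D_alg c)"
    if sq: "u \<otimes>\<^bsub>D_alg c\<^esub> u = quat_scalar s" and s: "s \<noteq> 0" for u s
  proof -
    define v where "v = quat_scalar (inverse s) \<otimes>\<^bsub>D_alg c\<^esub> u"
    have sc: "quat_scalar (inverse s) \<otimes>\<^bsub>D_alg c\<^esub> quat_scalar s = \<one>\<^bsub>D_alg c\<^esub>"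
      using s by (simp add: D_alg_def quaternion_algebra_def quat_scalar_def)
    have central: "u \<otimes>\<^bsub>D_alg c\<^esub> quat_scalar y = quat_scalar y \<otimes>\<^bsub>D_alg c\<^esub> u" for y
      by (simp add: D_alg_def quaternion_algebra_def quat_scalar_def mult_ac)
    have [simp]: "carrier (D_alg c) = UNIV" by (simp add: D_alg_def)
    have "v \<otimes>\<^bsub>D_alg c\<^esub> u = \<one>\<^bsub>D_alg c\<^esub>"
      by (simp add: v_def D.m_assoc sq sc)
    moreover have "u \<otimes>\<^bsub>D_alg c\<^esub> v = v \<otimes>\<^bsub>D_alg c\<^esub> u"
      by (simp add: v_def central flip: D.m_assoc)
    ultimately show ?thesis
      unfolding Units_def by auto
  qed
  obtain x y where \<xi>: "\<xi> = Quat (K_const x) (K_const y) 0 0"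
    using assms(2) by (auto simp: Fq_Z_def D_alg_def quaternion_algebra_def D_const_def quat_scalar_def quat_Z_def)
  have hom: "K_const (u * v) = K_const u * K_const v" "K_const (u - v) = K_const u - K_const v" for u v :: 'a
    by (simp_all add: K_const_def mult.commute)
  define P where "P = K_const c * K_t * K_t + K_const (x * x - c * (y * y)) * (K_t * (K_t - 1))"
  have "gamma c \<xi> \<otimes>\<^bsub>D_alg c\<^esub> gamma c \<xi> = quat_scalar P"
    by (simp add: gamma_def \<xi> P_def D_alg_def quaternion_algebra_def quat_scalar_def quat_Z_def
        quat_F_def hom algebra_simps)
  moreover have "P \<noteq> 0"
  proof
    define N where "N = x * x - c * (y * y)"
    assume "P = 0"
    moreover have "P = Fract [:0, - N, c + N:] 1"
      by (simp add: P_def N_def[symmetric] K_const_def K_t_def One_fract_def algebra_simps)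
    ultimately have "Fract [:0, - N, c + N:] 1 = 0"
      by simp
    then have "[:0, - N, c + N:] = 0"
      by (simp only: Zero_fract_def) (simp add: eq_fract del: pCons_eq_0_iff)
    then have "- N = 0" "c + N = 0"
      unfolding pCons_eq_0_iff by blast+
    then show False using assms(1) by simp
  qed
  ultimately have "gamma c \<xi> \<in> Units (D_alg c)"
    by (rule unitI)
  moreover have "quat_Z \<in> Units (D_alg c)"
  proof (rule unitI)
    show "quat_Z \<otimes>\<^bsub>D_alg c\<^esub> quat_Z = quat_scalar (K_const c)"
      unfolding D_alg_def by (rule quat_relations)
    show "K_const c \<noteq> 0"
      using assms(1) by (simp add: K_const_def Zero_fract_def eq_fract)
  qed
  ultimately show ?thesis
    by (rule D.Units_m_closed)
qed

lemma Gamma_gens_subset: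
  assumes "c \<noteq> 0"
  shows "Gamma_gens c \<tau> \<subseteq> carrier (D_proj c)"
  using gamma_Z_Units[OF assms]
  by (auto simp: Gamma_gens_def gamma_Z_class_def proj_class_def D_proj_def proj_units_def
      carrier_FactGroup units_of_carrier D_alg_def)

section \<open>Residually pro-\<open>p\<close> groups\<close>

text \<open>Every finite group is isomorphic to one whose elements are natural numbers, so quantifying
  over targets of type \<^typ>\<open>nat monoid\<close> loses nothing; see \<open>residually_pro_pI\<close>.\<close>

definition residually_pro_p :: "nat \<Rightarrow> ('g, 'm) monoid_scheme \<Rightarrow> bool" where
  "residually_pro_p p G \<longleftrightarrow>
    (\<forall>g \<in> carrier G. g \<noteq> \<one>\<^bsub>G\<^esub> \<longrightarrow>
      (\<exists>(H :: nat monoid) \<phi>. group H \<and> finite (carrier H) \<and> (\<exists>n. card (carrier H) = p ^ n) \<and>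
         \<phi> \<in> hom G H \<and> \<phi> g \<noteq> \<one>\<^bsub>H\<^esub>))"

lemma residually_pro_pI:
  fixes G :: "('g, 'm) monoid_scheme" and H :: "'g \<Rightarrow> 'h monoid"
  assumes "\<And>g. \<lbrakk>g \<in> carrier G; g \<noteq> \<one>\<^bsub>G\<^esub>\<rbrakk> \<Longrightarrow>
    group (H g) \<and> finite (carrier (H g)) \<and> (\<exists>n. card (carrier (H g)) = p ^ n) \<and>
    \<phi> g \<in> hom G (H g) \<and> \<phi> g g \<noteq> \<one>\<^bsub>H g\<^esub>"
  shows "residually_pro_p p G"
  unfolding residually_pro_p_def
proof (intro ballI impI)
  fix g assume g: "g \<in> carrier G" "g \<noteq> \<one>\<^bsub>G\<^esub>"
  define H' where "H' = H g"
  define f where "f = \<phi> g"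
  have H': "group H'" "finite (carrier H')" "\<exists>n. card (carrier H') = p ^ n" "f \<in> hom G H'"
    "f g \<noteq> \<one>\<^bsub>H'\<^esub>"
    using assms[OF g] by (auto simp: H'_def f_def)
  interpret H': group H' by fact
  obtain \<iota> :: "'h \<Rightarrow> nat" where \<iota>: "inj_on \<iota> (carrier H')"
    using finite_imp_inj_to_nat_seg[OF H'(2)] by blast
  define \<kappa> where "\<kappa> = the_inv_into (carrier H') \<iota>"
  have \<kappa> [simp]: "\<kappa> (\<iota> x) = x" if "x \<in> carrier H'" for x
    using that \<iota> by (simp add: \<kappa>_def the_inv_into_f_f)
  define N :: "nat monoid" where
    "N = \<lparr> carrier = \<iota> ` carrier H', monoid.mult = (\<lambda>x y. \<iota> (\<kappa> x \<otimes>\<^bsub>H'\<^esub> \<kappa> y)), one = \<iota> \<one>\<^bsub>H'\<^esub> \<rparr>"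
  have "group N"
  proof (rule groupI)
    fix x assume "x \<in> carrier N"
    then obtain y where y: "y \<in> carrier H'" "x = \<iota> y" by (auto simp: N_def)
    then show "\<exists>y\<in>carrier N. y \<otimes>\<^bsub>N\<^esub> x = \<one>\<^bsub>N\<^esub>"
      by (intro bexI[of _ "\<iota> (inv\<^bsub>H'\<^esub> y)"]) (auto simp: N_def)
  qed (auto simp: N_def H'.m_assoc)
  moreover have "finite (carrier N)" "\<exists>n. card (carrier N) = p ^ n"
    using H'(2,3) \<iota> by (simp_all add: N_def card_image)
  moreover have "\<iota> \<circ> f \<in> hom G N"
    using H'(4) by (auto simp: hom_def N_def Pi_def)
  moreover have "(\<iota> \<circ> f) g \<noteq> \<one>\<^bsub>N\<^esub>"
    using H'(4,5) g(1) inj_onD[OF \<iota>, of "f g" "\<one>\<^bsub>H'\<^esub>"] by (auto simp: N_def hom_def)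
  ultimately show "\<exists>(H :: nat monoid) \<phi>. group H \<and> finite (carrier H) \<and>
      (\<exists>n. card (carrier H) = p ^ n) \<and> \<phi> \<in> hom G H \<and> \<phi> g \<noteq> \<one>\<^bsub>H\<^esub>"
    by blast
qed

end

theory Submission
  imports Defs "HOL-Computational_Algebra.Polynomial_FPS"
begin

text \<open>The quaternion algebra ramifies at \<open>t = 1\<close>, where \<open>F\<^sup>2 = t (t - 1)\<close> vanishes to order one.  Since
  \<open>\<gamma>\<^sub>\<xi> Z = c t + \<xi> F Z\<close> is congruent to the scalar \<open>c\<close> modulo \<open>F\<close> at this place, every element of
  \<open>\<Gamma>\<^sub>\<tau>\<close> is the class of some \<open>x\<^sub>0 + x\<^sub>1 Z + x\<^sub>2 F + x\<^sub>3 ZF\<close> with \<open>x\<^sub>i \<in> \<bbbF>\<^sub>q[t]\<close>, \<open>x\<^sub>0(1) \<noteq> 0\<close> and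
  \<open>x\<^sub>1(1) = 0\<close>.  Such a class is determined by the quotients \<open>x\<^sub>i / x\<^sub>0\<close>, which expand into power series
  in \<open>t - 1\<close>.  Truncating these modulo \<open>(t - 1)\<^sup>n\<close> gives a homomorphism to a group of order
  \<open>q\<^bsup>3n-1\<^esup>\<close>, and a non-trivial class survives for large \<open>n\<close>.\<close>

section \<open>Quaternions over a commutative ring\<close>

text \<open>\<open>quaternion_algebra\<close> is set up over a field, but the product is also needed
  over polynomials and power series.\<close>

definition qmul :: "'k::comm_ring_1 \<Rightarrow> 'k \<Rightarrow> 'k quat \<Rightarrow> 'k quat \<Rightarrow> 'k quat" where
  "qmul a b x y = Quat
     (q0 x * q0 y + a * q1 x * q1 y + b * q2 x * q2 y - a * b * q3 x * q3 y)
     (q0 x * q1 y + q1 x * q0 y - b * q2 x * q3 y + b * q3 x * q2 y)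
     (q0 x * q2 y + q2 x * q0 y + a * q1 x * q3 y - a * q3 x * q1 y)
     (q0 x * q3 y + q3 x * q0 y + q1 x * q2 y - q2 x * q1 y)"

abbreviation qscale :: "'k::comm_ring_1 \<Rightarrow> 'k quat \<Rightarrow> 'k quat" where
  "qscale k \<equiv> map_quat ((*) k)"

definition qconj :: "'k::comm_ring_1 quat \<Rightarrow> 'k quat" where
  "qconj x = Quat (q0 x) (- q1 x) (- q2 x) (- q3 x)"

definition qnorm :: "'k::comm_ring_1 \<Rightarrow> 'k \<Rightarrow> 'k quat \<Rightarrow> 'k" where
  "qnorm a b x = q0 x * q0 x - a * q1 x * q1 x - b * q2 x * q2 x + a * b * q3 x * q3 x"

lemma qmul_quaternion_algebra: "x \<otimes>\<^bsub>quaternion_algebra a b\<^esub> y = qmul a b x y"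
  by (simp add: quaternion_algebra_def qmul_def)

lemma one_quaternion_algebra: "\<one>\<^bsub>quaternion_algebra a b\<^esub> = Quat 1 0 0 0"
  by (simp add: quaternion_algebra_def)

lemma qmul_assoc: "qmul a b (qmul a b x y) z = qmul a b x (qmul a b y z)"
  by (simp add: qmul_def algebra_simps)

lemma qmul_one [simp]: "qmul a b (Quat 1 0 0 0) x = x" "qmul a b x (Quat 1 0 0 0) = x"
  by (simp_all add: qmul_def)

lemma qmul_scale:
  "qmul a b (qscale k x) y = qscale k (qmul a b x y)"
  "qmul a b x (qscale k y) = qscale k (qmul a b x y)"
  by (simp_all add: qmul_def quat.map_sel algebra_simps)

lemma qmul_scalar: "qmul a b (Quat k 0 0 0) x = qscale k x"
  by (cases x) (simp add: qmul_def)

lemma qmul_conj: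
  "qmul a b x (qconj x) = Quat (qnorm a b x) 0 0 0"
  "qmul a b (qconj x) x = Quat (qnorm a b x) 0 0 0"
  by (simp_all add: qmul_def qconj_def qnorm_def algebra_simps)

lemma map_quat_qmul:
  assumes "\<And>x y. f (x * y) = f x * f y" "\<And>x y. f (x + y) = f x + f y" "\<And>x y. f (x - y) = f x - f y"
  shows "map_quat f (qmul a b x y) = qmul (f a) (f b) (map_quat f x) (map_quat f y)"
  by (simp add: qmul_def quat.map_sel assms)

section \<open>Normalised quaternions over power series\<close>

text \<open>By \<open>cong\<close> the fibres of \<open>f\<close> are the classes of a congruence,
  so multiplying chosen preimages gives a group law on the image. This realises a quotient of
  \<open>G\<close> on the target type itself.\<close>

lemma group_image:
  fixes f :: "'g \<Rightarrow> 'h"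
  assumes "group G"
    and cong: "\<And>x x' y y'. \<lbrakk>x \<in> carrier G; x' \<in> carrier G; y \<in> carrier G; y' \<in> carrier G; f x = f x'; f y = f y'\<rbrakk>
      \<Longrightarrow> f (x \<otimes>\<^bsub>G\<^esub> y) = f (x' \<otimes>\<^bsub>G\<^esub> y')"
  obtains H :: "'h monoid" where "group H" "carrier H = f ` carrier G" "f \<in> hom G H" "\<one>\<^bsub>H\<^esub> = f \<one>\<^bsub>G\<^esub>"
proof -
  interpret group G by fact
  define r where "r = inv_into (carrier G) f"
  have r: "r (f x) \<in> carrier G" "f (r (f x)) = f x" if "x \<in> carrier G" for x
    using that by (simp_all add: r_def inv_into_into f_inv_into_f)
  define H where "H = \<lparr>carrier = f ` carrier G, monoid.mult = (\<lambda>x y. f (r x \<otimes>\<^bsub>G\<^esub> r y)), one = f \<one>\<^bsub>G\<^esub>\<rparr>"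
  have mult: "f x \<otimes>\<^bsub>H\<^esub> f y = f (x \<otimes>\<^bsub>G\<^esub> y)" if "x \<in> carrier G" "y \<in> carrier G" for x y
    using that r by (auto simp: H_def intro!: cong)
  have car: "carrier H = f ` carrier G" and one: "\<one>\<^bsub>H\<^esub> = f \<one>\<^bsub>G\<^esub>"
    by (simp_all add: H_def)
  have "group H"
  proof (rule groupI)
    fix x assume "x \<in> carrier H"
    then obtain u where "u \<in> carrier G" "x = f u" by (auto simp: car)
    then show "\<exists>y\<in>carrier H. y \<otimes>\<^bsub>H\<^esub> x = \<one>\<^bsub>H\<^esub>"
      by (intro bexI[of _ "f (inv\<^bsub>G\<^esub> u)"]) (auto simp: car one mult)
  qed (auto simp: car one mult m_assoc)
  moreover have "f \<in> hom G H"
    by (auto simp: hom_def car mult)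
  ultimately show thesis
    using car one by (intro that[of H])
qed

text \<open>Meaningful only if \<open>q0 x\<close> is invertible, as \<open>inverse\<close> is \<open>0\<close> on non-units.\<close>

definition qaff :: "'a::field fps quat \<Rightarrow> 'a fps quat" where
  "qaff x = qscale (inverse (q0 x)) x"

text \<open>If \<open>b\<close> has constant term 0, reducing modulo \<open>F\<close> and the
  variable leaves only \<open>q0 + q1 Z\<close> at constant terms. The conditions say that this
  residue is a nonzero scalar, so projectively these elements are the analogue of principal
  units.\<close>

definition one_units :: "'a::field fps quat set" where
  "one_units = {x. fps_nth (q0 x) 0 \<noteq> 0 \<and> fps_nth (q1 x) 0 = 0}"

text \<open>At constant terms \<open>b\<close> and both \<open>q1\<close> vanish, so the residue of
  the product is the product of two nonzero scalars.\<close>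

lemma one_units_qmul:
  assumes "fps_nth b 0 = 0" "x \<in> one_units" "y \<in> one_units"
  shows "qmul a b x y \<in> one_units"
  using assms by (simp add: one_units_def qmul_def)

text \<open>Both scalars are units of the power series ring, so \<open>inverse\<close> really
  cancels them; this makes \<open>qaff\<close> a projective invariant.\<close>

lemma qaff_qscale:
  assumes "fps_nth k 0 \<noteq> 0" "fps_nth (q0 x) 0 \<noteq> 0"
  shows "qaff (qscale k x) = qaff x"
proof -
  have *: "inverse (k * q0 x) * (k * r) = inverse (q0 x) * r" for r
  proof -
    have "inverse (k * q0 x) * (k * r) = (inverse k * k) * (inverse (q0 x) * r)"
      by (simp add: fps_inverse_mult mult_ac)
    then show ?thesis by (simp add: inverse_mult_eq_1 assms)
  qed
  show ?thesis
    by (simp add: qaff_def quat.map_comp quat.map_sel o_def *)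
qed

text \<open>The inner \<open>qaff\<close> only multiplies by a unit scalar, which passes through
  \<open>qmul\<close> and is lost in the outer normalisation. Associativity of the normalised
  product rests on this.\<close>

lemma qaff_qmul_qaff:
  assumes "fps_nth b 0 = 0" "x \<in> one_units" "y \<in> one_units"
  shows "qaff (qmul a b (qaff x) y) = qaff (qmul a b x y)"
    and "qaff (qmul a b x (qaff y)) = qaff (qmul a b x y)"
proof -
  have "fps_nth (q0 (qmul a b x y)) 0 \<noteq> 0" "fps_nth (q0 x) 0 \<noteq> 0" "fps_nth (q0 y) 0 \<noteq> 0"
    using one_units_qmul[OF assms, of a] assms by (auto simp: one_units_def)
  then show "qaff (qmul a b (qaff x) y) = qaff (qmul a b x y)"
    "qaff (qmul a b x (qaff y)) = qaff (qmul a b x y)"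
    by (simp_all add: qaff_def[of x] qaff_def[of y] qmul_scale qaff_qscale)
qed

text \<open>Normal forms: each element of \<open>one_units\<close> is a unit scalar times exactly
  one element of this set.\<close>

definition affine_units :: "'a::field fps quat set" where
  "affine_units = {x. q0 x = 1 \<and> fps_nth (q1 x) 0 = 0}"

lemma affine_units_subset: "affine_units \<subseteq> one_units"
  by (auto simp: affine_units_def one_units_def)

lemma qaff_affine_units: "x \<in> one_units \<Longrightarrow> qaff x \<in> affine_units"
  by (simp add: one_units_def affine_units_def qaff_def quat.map_sel inverse_mult_eq_1)

lemma qaff_id: "x \<in> affine_units \<Longrightarrow> qaff x = x"
  by (cases x) (simp add: affine_units_def qaff_def)

text \<open>This is \<open>one_units\<close> modulo unit scalars, carried by normal forms instead of
  cosets so that coordinates can be truncated.\<close>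

definition affine_group :: "'a::field fps \<Rightarrow> 'a fps \<Rightarrow> 'a fps quat monoid" where
  "affine_group a b =
    \<lparr>carrier = affine_units, monoid.mult = (\<lambda>x y. qaff (qmul a b x y)), one = Quat 1 0 0 0\<rparr>"

lemma group_affine_group:
  assumes b: "fps_nth b 0 = 0"
  shows "group (affine_group a b)"
proof (rule groupI)
  fix x assume "x \<in> carrier (affine_group a b)"
  then have x: "x \<in> affine_units" by (simp add: affine_group_def)
  \<comment> \<open>The constant term of the norm is 1, as \<open>q0 x = 1\<close> and both
    \<open>q1 x\<close> and \<open>b\<close> have constant term 0. The norm is thus a unit scalar
    and the conjugate serves as inverse.\<close>
  then have "fps_nth (qnorm a b x) 0 \<noteq> 0"
    by (simp add: affine_units_def qnorm_def b)
  then have "qaff (qmul a b (qconj x) x) = Quat 1 0 0 0"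
    by (simp add: qmul_conj qaff_def inverse_mult_eq_1)
  moreover have "qconj x \<in> affine_units"
    using x by (simp add: affine_units_def qconj_def)
  ultimately show "\<exists>y\<in>carrier (affine_group a b). y \<otimes>\<^bsub>affine_group a b\<^esub> x = \<one>\<^bsub>affine_group a b\<^esub>"
    by (auto simp: affine_group_def)
next
  fix x y z
  assume "x \<in> carrier (affine_group a b)" "y \<in> carrier (affine_group a b)" "z \<in> carrier (affine_group a b)"
  then have "x \<in> one_units" "y \<in> one_units" "z \<in> one_units"
    using affine_units_subset by (auto simp: affine_group_def)
  then show "x \<otimes>\<^bsub>affine_group a b\<^esub> y \<otimes>\<^bsub>affine_group a b\<^esub> z = x \<otimes>\<^bsub>affine_group a b\<^esub> (y \<otimes>\<^bsub>affine_group a b\<^esub> z)"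
    by (simp add: affine_group_def qaff_qmul_qaff one_units_qmul b qmul_assoc)
next
  fix x y
  assume "x \<in> carrier (affine_group a b)" "y \<in> carrier (affine_group a b)"
  then show "x \<otimes>\<^bsub>affine_group a b\<^esub> y \<in> carrier (affine_group a b)"
    using affine_units_subset
    by (auto simp: affine_group_def intro!: qaff_affine_units one_units_qmul b)
qed (auto simp: affine_group_def qaff_id affine_units_def)

section \<open>Truncation modulo powers of the variable\<close>

lemma fps_cutoff_mult_cong:
  assumes "fps_cutoff n f = fps_cutoff n f'" "fps_cutoff n g = fps_cutoff n g'"
  shows "fps_cutoff n (f * g) = fps_cutoff n (f' * g')"
  \<comment> \<open>Coefficients of index below \<open>n\<close> of a product involve only such
    coefficients of the factors.\<close>
  using assms by (auto simp: fps_cutoff_eq_fps_cutoff_iff fps_mult_nth intro!: sum.cong)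

lemma fps_cutoff_inverse_cong:
  fixes f f' :: "'a::field fps"
  assumes "fps_cutoff n f = fps_cutoff n f'" "fps_nth f 0 \<noteq> 0" "fps_nth f' 0 \<noteq> 0"
  shows "fps_cutoff n (inverse f) = fps_cutoff n (inverse f')"
proof -
  \<comment> \<open>The sides differ only in the middle factor, \<open>f'\<close> against
    \<open>f\<close>; cancelling turns them into \<open>inverse f\<close> and
    \<open>inverse f'\<close>.\<close>
  have "fps_cutoff n (inverse f * (f' * inverse f')) = fps_cutoff n (inverse f * (f * inverse f'))"
    using assms(1) by (intro fps_cutoff_mult_cong refl) simp
  then show ?thesis
    using assms(2,3) by (simp add: inverse_mult_eq_1 inverse_mult_eq_1' flip: mult.assoc)
qed

lemma qtrunc_qaff_cong:
  assumes "map_quat (fps_cutoff n) x = map_quat (fps_cutoff n) x'"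
    and "fps_nth (q0 x) 0 \<noteq> 0" "fps_nth (q0 x') 0 \<noteq> 0"
  shows "map_quat (fps_cutoff n) (qaff x) = map_quat (fps_cutoff n) (qaff x')"
  using assms
  by (cases x; cases x') (auto simp: qaff_def intro!: fps_cutoff_mult_cong fps_cutoff_inverse_cong)

lemma qtrunc_qmul_cong:
  assumes "map_quat (fps_cutoff n) x = map_quat (fps_cutoff n) x'"
    and "map_quat (fps_cutoff n) y = map_quat (fps_cutoff n) y'"
  shows "map_quat (fps_cutoff n) (qmul a b x y) = map_quat (fps_cutoff n) (qmul a b x' y')"
  using assms
  by (cases x; cases x'; cases y; cases y')
    (auto simp: qmul_def fps_cutoff_add fps_cutoff_diff
      intro!: arg_cong2[of _ _ _ _ "(+)"] arg_cong2[of _ _ _ _ "(-)"] fps_cutoff_mult_cong)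

section \<open>Order of the truncated groups\<close>

lemma card_fps_supported:
  fixes I :: "nat set"
  assumes "finite I"
  shows "card {f :: 'a::{finite,zero} fps. \<forall>i. i \<notin> I \<longrightarrow> fps_nth f i = 0} = CARD('a) ^ card I"
proof -
  have "bij_betw (\<lambda>f. restrict (fps_nth f) I)
      {f :: 'a fps. \<forall>i. i \<notin> I \<longrightarrow> fps_nth f i = 0} (I \<rightarrow>\<^sub>E UNIV)"
  proof (rule bij_betw_byWitness[where f' = "\<lambda>g. Abs_fps (\<lambda>i. if i \<in> I then g i else 0)"])
    show "\<forall>g \<in> I \<rightarrow>\<^sub>E (UNIV :: 'a set). restrict (fps_nth (Abs_fps (\<lambda>i. if i \<in> I then g i else 0))) I = g"
    proof (intro ballI ext)
      fix g :: "nat \<Rightarrow> 'a" and i assume "g \<in> I \<rightarrow>\<^sub>E UNIV"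
      then show "restrict (fps_nth (Abs_fps (\<lambda>i. if i \<in> I then g i else 0))) I i = g i"
        by (cases "i \<in> I") (simp_all add: PiE_arb[of g])
    qed
  qed (auto simp: fps_eq_iff)
  then show ?thesis
    by (simp add: bij_betw_same_card card_funcsetE assms)
qed

text \<open>\<open>q0\<close> is fixed, \<open>q1\<close> is free in degrees 1 to n - 1 because its
  constant term vanishes, and \<open>q2\<close>, \<open>q3\<close> are free in degrees 0 to n - 1.
  For n = 0 both sides are 1.\<close>

lemma card_qtrunc_affine_units:
  "card (map_quat (fps_cutoff n) ` (affine_units :: 'a::finite_field fps quat set))
    = CARD('a) ^ (card {1..<n} + 2 * n)"
proof -
  define T where "T I = {f :: 'a fps. \<forall>i. i \<notin> I \<longrightarrow> fps_nth f i = 0}" for I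
  \<comment> \<open>The first coordinate is \<open>fps_cutoff n 1\<close> and not 1, because it is 0
    for n = 0.\<close>
  have "map_quat (fps_cutoff n) ` affine_units =
    (\<lambda>(f, g, h). Quat (fps_cutoff n 1) f g h) ` (T {1..<n} \<times> T {..<n} \<times> T {..<n})" (is "?L = ?R")
  proof
    show "?L \<subseteq> ?R"
    proof
      fix y assume "y \<in> ?L"
      then obtain x where "x \<in> affine_units" "y = map_quat (fps_cutoff n) x" by blast
      then show "y \<in> ?R"
        by (cases x, intro image_eqI[where x = "(q1 y, q2 y, q3 y)"])
          (auto simp: affine_units_def T_def Suc_le_eq)
    qed
    show "?R \<subseteq> ?L"
    proof
      fix y assume "y \<in> ?R"
      then obtain f g h where y: "y = Quat (fps_cutoff n 1) f g h"
        and fgh: "f \<in> T {1..<n}" "g \<in> T {..<n}" "h \<in> T {..<n}"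
        by auto
      have "fps_cutoff n f = f" "fps_cutoff n g = g" "fps_cutoff n h = h" "fps_nth f 0 = 0"
        using fgh by (auto simp: T_def fps_eq_iff)
      then show "y \<in> ?L"
        by (intro image_eqI[where x = "Quat 1 f g h"]) (simp_all add: y affine_units_def)
    qed
  qed
  then have "card ?L = card (T {1..<n} \<times> T {..<n} \<times> T {..<n})"
    by (simp only:) (rule card_image, auto simp: inj_on_def)
  also have "\<dots> = CARD('a) ^ (card {1..<n} + 2 * n)"
    unfolding card_cartesian_product T_def
    by (subst (1 2 3) card_fps_supported) (simp_all only: finite_lessThan finite_atLeastLessThan
        card_lessThan power_add mult_2)
  finally show ?thesis .
qed

text \<open>Products and normal forms modulo a power of the variable depend only on the truncated
  factors, so \<open>group_image\<close> applies.\<close>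

lemma affine_group_truncation:
  fixes a b :: "'a::finite_field fps"
  assumes b: "fps_nth b 0 = 0"
  obtains H :: "'a fps quat monoid" where "group H" "finite (carrier H)" "card (carrier H) = CARD('a) ^ (card {1..<n} + 2 * n)"
    "map_quat (fps_cutoff n) \<in> hom (affine_group a b) H"
    "\<one>\<^bsub>H\<^esub> = map_quat (fps_cutoff n) (Quat 1 0 0 0)"
proof (rule group_image[OF group_affine_group[OF b, of a], where f = "map_quat (fps_cutoff n)"])
  fix x x' y y' assume *: "x \<in> carrier (affine_group a b)" "x' \<in> carrier (affine_group a b)"
    "y \<in> carrier (affine_group a b)" "y' \<in> carrier (affine_group a b)"
    "map_quat (fps_cutoff n) x = map_quat (fps_cutoff n) x'"
    "map_quat (fps_cutoff n) y = map_quat (fps_cutoff n) y'"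
  then have "x \<in> one_units" "x' \<in> one_units" "y \<in> one_units" "y' \<in> one_units"
    using affine_units_subset by (auto simp: affine_group_def)
  then have "qmul a b x y \<in> one_units" "qmul a b x' y' \<in> one_units"
    by (simp_all add: one_units_qmul b)
  then show "map_quat (fps_cutoff n) (x \<otimes>\<^bsub>affine_group a b\<^esub> y) =
      map_quat (fps_cutoff n) (x' \<otimes>\<^bsub>affine_group a b\<^esub> y')"
    using * by (auto simp: affine_group_def one_units_def intro!: qtrunc_qaff_cong qtrunc_qmul_cong)
next
  fix H :: "'a fps quat monoid" assume H: "group H" "carrier H = map_quat (fps_cutoff n) ` carrier (affine_group a b)"
    "map_quat (fps_cutoff n) \<in> hom (affine_group a b) H"
    "\<one>\<^bsub>H\<^esub> = map_quat (fps_cutoff n) \<one>\<^bsub>affine_group a b\<^esub>"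
  then have card: "card (carrier H) = CARD('a) ^ (card {1..<n} + 2 * n)"
    using card_qtrunc_affine_units[where 'a = 'a] by (simp add: affine_group_def)
  \<comment> \<open>An infinite set has \<open>card\<close> 0, so a positive cardinality yields
    finiteness.\<close>
  moreover from this have "finite (carrier H)"
    by (intro card_ge_0_finite) simp
  ultimately show thesis
    using H by (intro that[of H]) (auto simp: affine_group_def)
qed

section \<open>The projective group of the quaternion algebra\<close>

context
  fixes a b :: "'k::field"
begin

abbreviation (input) "U \<equiv> units_of (quaternion_algebra a b)"

lemma quat_Units:
  assumes "qnorm a b u \<noteq> 0"
  shows "u \<in> Units (quaternion_algebra a b)"
proof -
  let ?v = "qscale (inverse (qnorm a b u)) (qconj u)"
  have "qmul a b u ?v = Quat 1 0 0 0" "qmul a b ?v u = Quat 1 0 0 0"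
    using assms by (simp_all add: qmul_scale qmul_conj)
  then show ?thesis
    unfolding Units_def by (auto simp: qmul_quaternion_algebra one_quaternion_algebra)
qed

lemma proj_class_mult:
  assumes "u \<in> Units (quaternion_algebra a b)" "v \<in> Units (quaternion_algebra a b)"
  shows "proj_class a b u \<otimes>\<^bsub>proj_units a b\<^esub> proj_class a b v = proj_class a b (qmul a b u v)"
proof -
  interpret normal quat_scalar_units U by (rule quat_scalar_units_normal)
  show ?thesis
    using assms rcos_sum[of u v]
    by (simp add: proj_units_def proj_class_def FactGroup_def units_of_carrier units_of_mult
        qmul_quaternion_algebra)
qed

lemma proj_class_carrier:
  assumes "u \<in> Units (quaternion_algebra a b)"
  shows "proj_class a b u \<in> carrier (proj_units a b)"
  using assms by (auto simp: proj_units_def proj_class_def carrier_FactGroup units_of_carrier)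

lemma proj_class_scalar:
  assumes "k \<noteq> 0"
  shows "proj_class a b (Quat k 0 0 0) = \<one>\<^bsub>proj_units a b\<^esub>"
proof -
  interpret normal quat_scalar_units U by (rule quat_scalar_units_normal)
  have "Quat k 0 0 0 \<in> quat_scalar_units"
    using assms by (auto simp: quat_scalar_units_def quat_scalar_def)
  then show ?thesis
    using rcos_const[OF is_group] by (simp add: proj_units_def proj_class_def FactGroup_def)
qed

lemma proj_class_eqD:
  assumes "u \<in> Units (quaternion_algebra a b)" "proj_class a b u = proj_class a b v"
  obtains k where "k \<noteq> 0" "u = qscale k v"
proof -
  interpret normal quat_scalar_units U by (rule quat_scalar_units_normal)
  have "u \<in> proj_class a b u"
    using assms(1) rcos_self[OF _ is_subgroup] by (simp add: proj_class_def units_of_carrier)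
  then have "u \<in> proj_class a b v"
    using assms(2) by simp
  then show thesis
    using that
    by (auto simp: proj_class_def r_coset_def quat_scalar_units_def quat_scalar_def units_of_mult
        qmul_quaternion_algebra qmul_scalar)
qed

end

section \<open>Integral representatives at \<open>t = 1\<close>\<close>

definition poly_const :: "'a::field poly \<Rightarrow> 'a poly fract" where
  "poly_const p = Fract p 1"

lemma poly_const_hom:
  "poly_const (x * y) = poly_const x * poly_const y"
  "poly_const (x + y) = poly_const x + poly_const y"
  "poly_const (x - y) = poly_const x - poly_const y"
  by (simp_all add: poly_const_def)

lemma poly_const_eq_iff: "poly_const x = poly_const y \<longleftrightarrow> x = y"
  by (simp add: poly_const_def eq_fract)

lemma poly_const_0 [simp]: "poly_const 0 = 0"
  by (simp add: poly_const_def Zero_fract_def)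

lemma poly_const_eq_0_iff [simp]: "poly_const x = 0 \<longleftrightarrow> x = 0"
  using poly_const_eq_iff[of x 0] by simp

text \<open>Taylor expansion at \<open>t = 1\<close>: after substituting \<open>1 + X\<close> for
  \<open>t\<close>, the series variable stands for \<open>t - 1\<close>.\<close>

definition expand1 :: "'a::field poly \<Rightarrow> 'a fps" where
  "expand1 p = fps_of_poly (pcompose p [:1, 1:])"

lemma expand1_hom:
  "expand1 (x * y) = expand1 x * expand1 y"
  "expand1 (x + y) = expand1 x + expand1 y"
  "expand1 (x - y) = expand1 x - expand1 y"
  by (simp_all add: expand1_def pcompose_mult pcompose_add pcompose_diff
      fps_of_poly_mult fps_of_poly_add fps_of_poly_diff)

lemma expand1_eq_0_iff: "expand1 p = 0 \<longleftrightarrow> p = 0"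
proof -
  have "expand1 p = 0 \<longleftrightarrow> pcompose p [:1, 1:] = 0"
    unfolding expand1_def by (metis fps_of_poly_0 fps_of_poly_eq_iff)
  then show ?thesis by (simp add: pcompose_eq_0_iff)
qed

lemma expand1_nth_0: "fps_nth (expand1 p) 0 = poly p 1"
  by (simp add: expand1_def poly_pcompose flip: poly_0_coeff_0)

text \<open>Values at 1 are the constant terms of the expansions, so this is the polynomial
  counterpart of \<open>one_units\<close>. Working modulo scalars avoids denominators.\<close>

definition poly_one_units :: "'a::field poly quat set" where
  "poly_one_units = {u. poly (q0 u) 1 \<noteq> 0 \<and> poly (q1 u) 1 = 0}"

lemma expand1_one_units: "u \<in> poly_one_units \<Longrightarrow> map_quat expand1 u \<in> one_units"
  by (simp add: poly_one_units_def one_units_def quat.map_sel expand1_nth_0)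

context
  fixes a b :: "'a::field poly"
  assumes b1: "poly b 1 = 0"
begin

lemma poly_one_units_qmul:
  assumes "u \<in> poly_one_units" "v \<in> poly_one_units"
  shows "qmul a b u v \<in> poly_one_units"
  using assms by (simp add: poly_one_units_def qmul_def b1)

lemma poly_one_units_Units:
  assumes "u \<in> poly_one_units"
  shows "map_quat poly_const u \<in> Units (quaternion_algebra (poly_const a) (poly_const b))"
proof (rule quat_Units)
  \<comment> \<open>At 1 the norm reduces to the square of \<open>q0 u\<close>.\<close>
  have "poly (qnorm a b u) 1 \<noteq> 0"
    using assms by (simp add: poly_one_units_def qnorm_def b1)
  then have "qnorm a b u \<noteq> 0" by auto
  moreover have "qnorm (poly_const a) (poly_const b) (map_quat poly_const u) = poly_const (qnorm a b u)"
    by (simp add: qnorm_def quat.map_sel poly_const_hom)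
  ultimately show "qnorm (poly_const a) (poly_const b) (map_quat poly_const u) \<noteq> 0"
    by simp
qed

abbreviation "P \<equiv> proj_units (poly_const a) (poly_const b)"

definition poly_class :: "'a poly quat \<Rightarrow> 'a poly fract quat set" where
  "poly_class u = proj_class (poly_const a) (poly_const b) (map_quat poly_const u)"

lemma poly_class_mult:
  assumes "u \<in> poly_one_units" "v \<in> poly_one_units"
  shows "poly_class u \<otimes>\<^bsub>P\<^esub> poly_class v = poly_class (qmul a b u v)"
  using assms
  by (simp add: poly_class_def proj_class_mult poly_one_units_Units map_quat_qmul poly_const_hom)

lemma poly_class_scalar:
  assumes "p \<noteq> 0"
  shows "poly_class (Quat p 0 0 0) = \<one>\<^bsub>P\<^esub>"
  using assms by (simp add: poly_class_def proj_class_scalar)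

lemma poly_class_carrier: "u \<in> poly_one_units \<Longrightarrow> poly_class u \<in> carrier P"
  by (simp add: poly_class_def proj_class_carrier poly_one_units_Units)

text \<open>Inverses stay polynomial: \<open>u\<close> times its conjugate is the norm, a nonzero
  scalar and hence projectively trivial, so the conjugate represents the inverse class.\<close>

lemma subgroup_poly_class: "subgroup (poly_class ` poly_one_units) P"
proof -
  interpret group P by (rule proj_units_group)
  show ?thesis
  proof (rule subgroupI)
    show "poly_class ` poly_one_units \<subseteq> carrier P"
      using poly_class_carrier by blast
    have "Quat 1 0 0 0 \<in> (poly_one_units :: 'a poly quat set)"
      by (simp add: poly_one_units_def)
    then show "poly_class ` poly_one_units \<noteq> {}" by blast
  next
    fix g assume "g \<in> poly_class ` poly_one_units"
    then obtain u where u: "u \<in> poly_one_units" "g = poly_class u" by blast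
    have conj: "qconj u \<in> poly_one_units"
      using u(1) by (simp add: poly_one_units_def qconj_def)
    have "poly (qnorm a b u) 1 \<noteq> 0"
      using u(1) by (simp add: poly_one_units_def qnorm_def b1)
    then have "qnorm a b u \<noteq> 0" by auto
    then have "poly_class (qconj u) \<otimes>\<^bsub>P\<^esub> g = \<one>\<^bsub>P\<^esub>"
      using u conj by (simp add: poly_class_mult qmul_conj poly_class_scalar)
    then have "inv\<^bsub>P\<^esub> g = poly_class (qconj u)"
      using u conj by (intro inv_equality) (auto intro: poly_class_carrier)
    with conj show "inv\<^bsub>P\<^esub> g \<in> poly_class ` poly_one_units" by blast
  next
    fix g h assume "g \<in> poly_class ` poly_one_units" "h \<in> poly_class ` poly_one_units"
    then show "g \<otimes>\<^bsub>P\<^esub> h \<in> poly_class ` poly_one_units"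
      by (auto simp: poly_class_mult poly_one_units_qmul)
  qed
qed

section \<open>Power series coordinates of a projective class\<close>

lemma qaff_expand1_cong:
  assumes u: "u \<in> poly_one_units" and v: "v \<in> poly_one_units" and eq: "poly_class u = poly_class v"
  shows "qaff (map_quat expand1 u) = qaff (map_quat expand1 v)"
proof -
  obtain k where k: "map_quat poly_const u = qscale k (map_quat poly_const v)"
    using proj_class_eqD[OF poly_one_units_Units[OF u] eq[unfolded poly_class_def]] by blast
  \<comment> \<open>Cross-multiplying by the leading coordinates eliminates the fraction \<open>k\<close>.\<close>
  have cross: "q0 v * x = q0 u * y" if "poly_const x = k * poly_const y" for x y
  proof -
    have "poly_const (q0 u) = k * poly_const (q0 v)"
      using k by (metis quat.map_sel(1))
    then have "poly_const (q0 v * x) = poly_const (q0 u * y)"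
      using that by (simp add: poly_const_hom mult_ac)
    then show ?thesis by (simp only: poly_const_eq_iff)
  qed
  have "qscale (q0 v) u = qscale (q0 u) v"
    using k[THEN arg_cong, of q0] k[THEN arg_cong, of q1] k[THEN arg_cong, of q2] k[THEN arg_cong, of q3]
    by (intro quat.expand) (simp add: quat.map_sel cross)
  then have "map_quat expand1 (qscale (q0 v) u) = map_quat expand1 (qscale (q0 u) v)"
    by simp
  then have "qscale (expand1 (q0 v)) (map_quat expand1 u) = qscale (expand1 (q0 u)) (map_quat expand1 v)"
    by (simp add: quat.map_comp o_def expand1_hom)
  \<comment> \<open>Leading coordinates do not vanish at 1, so their expansions are unit scalars and
    drop out under \<open>qaff\<close>.\<close>
  moreover have "qaff (qscale (expand1 (q0 v)) (map_quat expand1 u)) = qaff (map_quat expand1 u)"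
    "qaff (qscale (expand1 (q0 u)) (map_quat expand1 v)) = qaff (map_quat expand1 v)"
    using u v by (auto intro!: qaff_qscale simp: poly_one_units_def expand1_nth_0 quat.map_sel)
  ultimately show ?thesis by metis
qed

text \<open>By \<open>qaff_expand1_cong\<close> the choice of representative does not matter; on
  classes without one in \<open>poly_one_units\<close> the value is arbitrary.\<close>

definition class_aff :: "'a poly fract quat set \<Rightarrow> 'a fps quat" where
  "class_aff g = qaff (map_quat expand1 (SOME u. u \<in> poly_one_units \<and> poly_class u = g))"

lemma class_aff_poly_class:
  assumes "u \<in> poly_one_units"
  shows "class_aff (poly_class u) = qaff (map_quat expand1 u)"
proof -
  have "(SOME v. v \<in> poly_one_units \<and> poly_class v = poly_class u) \<in> poly_one_units \<and>
      poly_class (SOME v. v \<in> poly_one_units \<and> poly_class v = poly_class u) = poly_class u"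
    by (rule someI) (use assms in auto)
  then show ?thesis
    unfolding class_aff_def using assms by (intro qaff_expand1_cong) auto
qed

text \<open>Expansion is a ring homomorphism and so commutes with \<open>qmul\<close>; normalising
  the factors first does not change the normalised product.\<close>

lemma class_aff_hom:
  "class_aff \<in> hom (P\<lparr>carrier := poly_class ` poly_one_units\<rparr>) (affine_group (expand1 a) (expand1 b))"
proof (rule homI)
  fix g assume "g \<in> carrier (P\<lparr>carrier := poly_class ` poly_one_units\<rparr>)"
  then show "class_aff g \<in> carrier (affine_group (expand1 a) (expand1 b))"
    by (auto simp: class_aff_poly_class affine_group_def qaff_affine_units expand1_one_units)
next
  fix g h assume "g \<in> carrier (P\<lparr>carrier := poly_class ` poly_one_units\<rparr>)"
    "h \<in> carrier (P\<lparr>carrier := poly_class ` poly_one_units\<rparr>)"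
  then obtain u v where uv: "u \<in> poly_one_units" "g = poly_class u" "v \<in> poly_one_units" "h = poly_class v"
    by auto
  have b: "fps_nth (expand1 b) 0 = 0" by (simp add: expand1_nth_0 b1)
  note mem = uv(1,3)[THEN expand1_one_units]
  note aff = subsetD[OF affine_units_subset qaff_affine_units]
  show "class_aff (g \<otimes>\<^bsub>P\<lparr>carrier := poly_class ` poly_one_units\<rparr>\<^esub> h) =
      class_aff g \<otimes>\<^bsub>affine_group (expand1 a) (expand1 b)\<^esub> class_aff h"
    using uv mem
    by (simp add: poly_class_mult class_aff_poly_class poly_one_units_qmul affine_group_def aff
        map_quat_qmul expand1_hom qaff_qmul_qaff b)
qed

text \<open>A representative of a non-trivial class is not a scalar, so one of \<open>q1\<close>,
  \<open>q2\<close>, \<open>q3\<close> is nonzero, and its expansion is nonzero too. A power series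
  is determined by all its truncations.\<close>

lemma class_aff_nontrivial:
  assumes "u \<in> poly_one_units" "poly_class u \<noteq> \<one>\<^bsub>P\<^esub>"
  obtains n where
    "map_quat (fps_cutoff n) (class_aff (poly_class u)) \<noteq> map_quat (fps_cutoff n) (Quat 1 0 0 0)"
proof -
  obtain x0 x1 x2 x3 where u: "u = Quat x0 x1 x2 x3" by (cases u)
  have x0: "poly x0 1 \<noteq> 0" using assms(1) by (simp add: u poly_one_units_def)
  then have "x0 \<noteq> 0" by auto
  with assms(2) have "x1 \<noteq> 0 \<or> x2 \<noteq> 0 \<or> x3 \<noteq> 0"
    using poly_class_scalar[of x0] by (auto simp: u)
  moreover have "inverse (expand1 x0) \<noteq> 0"
    using x0 by (simp add: expand1_nth_0)
  ultimately have "class_aff (poly_class u) \<noteq> Quat 1 0 0 0"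
    by (simp add: class_aff_poly_class[OF assms(1)]) (auto simp: u qaff_def expand1_eq_0_iff)
  moreover have "x = y" if *: "\<And>n. map_quat (fps_cutoff n) x = map_quat (fps_cutoff n) y"
    for x y :: "'a fps quat"
  proof -
    have "f = g" if "\<And>n. fps_cutoff n f = fps_cutoff n g" for f g :: "'a fps"
    proof (rule fps_ext)
      fix n
      show "fps_nth f n = fps_nth g n"
        \<comment> \<open>Truncation at \<open>Suc n\<close> is the first that retains the
          coefficient of index \<open>n\<close>.\<close>
        using that[of "Suc n"] by (simp add: fps_cutoff_eq_fps_cutoff_iff del: fps_cutoff_nth)
    qed
    then show ?thesis
      using * by (cases x; cases y) simp
  qed
  ultimately show thesis using that by blast
qed

end

text \<open>\<open>class_aff\<close> followed by truncation maps to a group whose order is a power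
  of \<open>q\<close>, hence of \<open>p\<close>; the truncation level depends on the element to be
  separated. Such maps restrict to \<open>A\<close>.\<close>

lemma residually_pro_p_poly_class_subgroup:
  fixes a b :: "'a::finite_field poly"
  assumes b1: "poly b 1 = 0" and q: "CARD('a) = p ^ m"
    and sub: "A \<subseteq> poly_class a b ` poly_one_units"
  shows "residually_pro_p p (proj_units (poly_const a) (poly_const b) \<lparr>carrier := A\<rparr>)"
    (is "residually_pro_p p ?G")
proof -
  have "\<exists>(H :: 'a fps quat monoid) \<phi>. group H \<and> finite (carrier H) \<and> (\<exists>n. card (carrier H) = p ^ n) \<and>
      \<phi> \<in> hom ?G H \<and> \<phi> g \<noteq> \<one>\<^bsub>H\<^esub>"
    if g: "g \<in> carrier ?G" "g \<noteq> \<one>\<^bsub>?G\<^esub>" for g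
  proof -
    obtain u where u: "u \<in> poly_one_units" "g = poly_class a b u"
      using g(1) sub by auto
    obtain n where n: "map_quat (fps_cutoff n) (class_aff a b g) \<noteq> map_quat (fps_cutoff n) (Quat 1 0 0 0)"
      using class_aff_nontrivial[OF b1 u(1)] g(2) u(2) by auto
    have b: "fps_nth (expand1 b) 0 = 0" by (simp add: expand1_nth_0 b1)
    obtain H :: "'a fps quat monoid" where H: "group H" "finite (carrier H)"
      "card (carrier H) = CARD('a) ^ (card {1..<n} + 2 * n)"
      "map_quat (fps_cutoff n) \<in> hom (affine_group (expand1 a) (expand1 b)) H"
      "\<one>\<^bsub>H\<^esub> = map_quat (fps_cutoff n) (Quat 1 0 0 0)"
      by (rule affine_group_truncation[OF b])
    have "class_aff a b \<in> hom ?G (affine_group (expand1 a) (expand1 b))"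
      using hom_in_carrier[OF class_aff_hom[OF b1, of a]] hom_mult[OF class_aff_hom[OF b1, of a]] sub
      by (intro homI) (simp_all add: subset_iff)
    then have "map_quat (fps_cutoff n) \<circ> class_aff a b \<in> hom ?G H"
      using H(4) by (rule hom_compose)
    moreover have "\<exists>k. card (carrier H) = p ^ k"
      unfolding H(3) q by (metis power_mult)
    ultimately show ?thesis
      using H(1,2,5) n by (intro exI[of _ H] exI[of _ "map_quat (fps_cutoff n) \<circ> class_aff a b"]) simp
  qed
  \<comment> \<open>Choosing \<open>H\<close> and \<open>\<phi>\<close> as functions of
    \<open>g\<close> gives the form that \<open>residually_pro_pI\<close> needs to pass to groups on
    natural numbers.\<close>
  then obtain H :: "_ \<Rightarrow> 'a fps quat monoid" and \<phi> where
    "\<And>g. \<lbrakk>g \<in> carrier ?G; g \<noteq> \<one>\<^bsub>?G\<^esub>\<rbrakk> \<Longrightarrow> group (H g) \<and> finite (carrier (H g)) \<and>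
      (\<exists>n. card (carrier (H g)) = p ^ n) \<and> \<phi> g \<in> hom ?G (H g) \<and> \<phi> g g \<noteq> \<one>\<^bsub>H g\<^esub>"
    by metis
  then show ?thesis by (rule residually_pro_pI)
qed

section \<open>The generators\<close>

lemma K_base:
  "K_const c = poly_const [:c:]"
  "K_t * (K_t - 1) = poly_const [:0, -1, 1 :: 'a::finite_field:]"
  by (simp_all add: K_const_def K_t_def poly_const_def One_fract_def one_pCons)

lemma gamma_Z_class_poly_class:
  fixes c :: "'a::finite_field"
  assumes "c \<noteq> 0" "\<xi> \<in> Fq_Z c"
  shows "gamma_Z_class c \<xi> \<in> poly_class [:c:] [:0, -1, 1:] ` poly_one_units"
proof -
  obtain x y where \<xi>: "\<xi> = Quat (K_const x) (K_const y) 0 0"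
    using assms(2)
    by (auto simp: Fq_Z_def D_alg_def quaternion_algebra_def D_const_def quat_scalar_def quat_Z_def)
  \<comment> \<open>From \<open>F Z = - Z F\<close> and \<open>Z^2 = c\<close>, the product is
    \<open>c t - \<xi> Z F\<close>; inserting \<open>\<xi> = x + y Z\<close> gives these
    coordinates. The leading one takes the value \<open>c\<close> at 1.\<close>
  let ?u = "Quat [:0, c:] 0 [:- (c * y):] [:- x:]"
  have "gamma c \<xi> \<otimes>\<^bsub>D_alg c\<^esub> quat_Z = Quat (K_const c * K_t) 0 (- (K_const c * K_const y)) (- K_const x)"
    by (simp add: \<xi> gamma_def D_alg_def quaternion_algebra_def quat_scalar_def quat_Z_def quat_F_def)
  also have "\<dots> = map_quat poly_const ?u"
    by (simp add: K_const_def K_t_def poly_const_def mult.commute fract_collapse)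
  finally have "gamma c \<xi> \<otimes>\<^bsub>D_alg c\<^esub> quat_Z = map_quat poly_const ?u" .
  moreover have "?u \<in> poly_one_units"
    using assms(1) by (simp add: poly_one_units_def)
  ultimately show ?thesis
    by (intro image_eqI[where x = ?u]) (simp_all add: gamma_Z_class_def K_base poly_class_def)
qed

theorem proposition36:
  fixes p q n :: nat and c \<tau> :: "'a::finite_field"
  assumes "prime p" and "odd p"
    and "n > 0" and "q = p ^ n" and "CARD('a) = q"
    and "c \<noteq> 0" and "\<not> (\<exists>x. c = x\<^sup>2)"
    and "\<tau> \<noteq> 0" and "\<tau> \<noteq> 1"
  shows "residually_pro_p p (Gamma_group c \<tau>)"
proof -
  \<comment> \<open>This is \<open>t (t - 1)\<close>; its root 1 is the place of expansion.\<close>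
  let ?b = "[:0, -1, 1:] :: 'a poly"
  have b1: "poly ?b 1 = 0" by simp
  have D: "D_proj c = proj_units (poly_const [:c:]) (poly_const ?b)"
    by (simp add: D_proj_def K_base)
  interpret group "D_proj c" unfolding D_proj_def by (rule proj_units_group)
  have "generate (D_proj c) (Gamma_gens c \<tau>) \<subseteq> poly_class [:c:] ?b ` poly_one_units"
  proof (rule generate_subgroup_incl)
    show "Gamma_gens c \<tau> \<subseteq> poly_class [:c:] ?b ` poly_one_units"
      using gamma_Z_class_poly_class[OF \<open>c \<noteq> 0\<close>] by (auto simp: Gamma_gens_def)
    show "subgroup (poly_class [:c:] ?b ` poly_one_units) (D_proj c)"
      unfolding D by (rule subgroup_poly_class[OF b1])
  qed
  then show ?thesis
    unfolding Gamma_group_def D using assms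
    by (intro residually_pro_p_poly_class_subgroup b1) auto
qed

end
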